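(* Let $m\ge5$ and $n\ge4$ be integers. Then, with $k$ an integer, $$\widetilde\chi(\mathrm{Hom}(C_m,K_n))=\begin{cases}(-1)^{nk-m},&\text{if } m=3k\pm1,\\ (-1)^{nk-m}(2^n-3),&\text{if } m=3k.\end{cases}$$
   Context: $C_m$ is the cycle with $m$ vertices, and $K_n$ is the complete loopless graph on $n$ vertices. $\mathrm{Hom}(T,G)$ is the subcomplex of $\prod_{x\in V(T)}\Delta^{V(G)}$ consisting of all cells $\prod_{x\in V(T)}\sigma_x$, with each $\sigma_x$ a nonempty subset of $V(G)$, such that whenever $(x,y)\in E(T)$ one has $\sigma_x\times\sigma_y\subseteq E(G)$. $\widetilde\chi=\chi-1$ denotes the reduced Euler characteristic. *)

theory Defs
  imports Complex_Main "HOL-Library.FuncSet" "Graph_Theory.Kuratowski"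
begin

text \<open>
  A graph is given by its vertex set \<^const>\<open>pverts\<close> and its edge relation \<^const>\<open>parcs\<close>,
  which for an undirected graph is symmetric.
\<close>

definition cycle_graph :: "nat \<Rightarrow> nat pair_pre_digraph" where
  "cycle_graph m = \<lparr> pverts = {..<m},
     parcs = {(i, j). i < m \<and> j < m \<and> (j = (i + 1) mod m \<or> i = (j + 1) mod m)} \<rparr>"

definition complete_graph :: "nat \<Rightarrow> nat pair_pre_digraph" where
  "complete_graph n = \<lparr> pverts = {..<n}, parcs = {(i, j). i < n \<and> j < n \<and> i \<noteq> j} \<rparr>"

text \<open>
  The nonempty faces of the simplex \<open>\<Delta>\<^sup>V\<close> correspond to the nonempty finite subsets of \<open>V\<close>.
  For finite \<open>X\<close>, a cell \<open>\<Prod>x\<in>X. \<sigma> x\<close> of \<open>\<Prod>x\<in>X. \<Delta>\<^sup>V\<close> is represented by the family \<open>\<sigma>\<close> of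
  vertex sets of its factors (extended by \<^const>\<open>undefined\<close> outside of \<open>X\<close>).  A simplex with
  vertex set \<open>\<sigma> x\<close> has dimension \<open>card (\<sigma> x) - 1\<close>, and dimensions add up in products.
\<close>

definition simplex_product :: "'a set \<Rightarrow> 'b set \<Rightarrow> ('a \<Rightarrow> 'b set) set" where
  "simplex_product X V = (X \<rightarrow>\<^sub>E {S. S \<subseteq> V \<and> finite S \<and> S \<noteq> {}})"

definition cell_dim :: "'a set \<Rightarrow> ('a \<Rightarrow> 'b set) \<Rightarrow> nat" where
  "cell_dim X \<sigma> = (\<Sum>x\<in>X. (card (\<sigma> x) - 1))"

definition Hom_complex ::
  "'a pair_pre_digraph \<Rightarrow> 'b pair_pre_digraph \<Rightarrow> ('a \<Rightarrow> 'b set) set" where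
  "Hom_complex T G = {\<sigma> \<in> simplex_product (pverts T) (pverts G).
     \<forall>(x, y) \<in> parcs T. \<sigma> x \<times> \<sigma> y \<subseteq> parcs G}"

text \<open>
  The Euler characteristic of a finite subcomplex \<open>K\<close> of \<open>\<Prod>x\<in>X. \<Delta>\<^sup>V\<close>, the alternating sum of the
  numbers of its cells in each dimension.
\<close>

definition euler_char :: "'a set \<Rightarrow> ('a \<Rightarrow> 'b set) set \<Rightarrow> int" where
  "euler_char X K = (\<Sum>\<sigma>\<in>K. (- 1) ^ cell_dim X \<sigma>)"

definition reduced_euler_char :: "'a set \<Rightarrow> ('a \<Rightarrow> 'b set) set \<Rightarrow> int" where
  "reduced_euler_char X K = euler_char X K - 1"

lemma complete_graph_is_complete_digraph: "complete_digraph n (with_proj (complete_graph n))"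
  by (auto simp: complete_digraph_pair_def complete_graph_def)

lemma cycle_graph_is_pair_graph:
  assumes "m \<ge> 2"
  shows "pair_graph (cycle_graph m)"
proof
  show "finite (parcs (cycle_graph m))"
    by (rule finite_subset[of _ "{..<m} \<times> {..<m}"]) (auto simp: cycle_graph_def)
  fix e assume "e \<in> parcs (cycle_graph m)"
  then show "fst e \<noteq> snd e"
    using assms by (auto simp: cycle_graph_def mod_Suc split: if_splits)
qed (auto simp: cycle_graph_def symmetric_def intro!: symI)

lemma Hom_complex_subcomplex:
  assumes "\<sigma> \<in> Hom_complex T G" "\<tau> \<in> simplex_product (pverts T) (pverts G)"
    and "parcs T \<subseteq> pverts T \<times> pverts T" "\<And>x. x \<in> pverts T \<Longrightarrow> \<tau> x \<subseteq> \<sigma> x"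
  shows "\<tau> \<in> Hom_complex T G"
  using assms unfolding Hom_complex_def by blast

lemma finite_Hom_complex:
  assumes "finite (pverts T)" "finite (pverts G)"
  shows "finite (Hom_complex T G)"
proof (rule finite_subset)
  show "Hom_complex T G \<subseteq> (pverts T \<rightarrow>\<^sub>E Pow (pverts G))"
    unfolding Hom_complex_def simplex_product_def by (simp add: PiE_iff subset_iff)
  show "finite (pverts T \<rightarrow>\<^sub>E Pow (pverts G))"
    using assms by (intro finite_PiE) auto
qed

end

theory Submission
  imports Defs
begin

text \<open>
  Cells of \<open>Hom(C\<^sub>m, K\<^sub>n)\<close> are closed walks of length \<open>m\<close> in the disjointness graph on the nonempty
  subsets of \<open>{..<n}\<close>, so the Euler characteristic is the trace of the \<open>m\<close>-th power of a signed
  adjacency matrix.  Once the empty set is admitted as a vertex, this matrix becomes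
  \<open>M = - P \<otimes> \<dots> \<otimes> P\<close> with \<open>n\<close> factors \<open>P = (1, 1; -1, 0)\<close>.  Since \<open>P\<^sup>3 = -1\<close>, we have \<open>M\<^sup>3 = c\<close>
  with \<open>c = (-1)\<^bsup>n+1\<^esup>\<close>.  Forbidding the empty set again replaces \<open>M\<close> by \<open>X = M - u e\<^sup>T\<close>, where \<open>e\<close>
  is the basis vector of the empty set and \<open>u = M e\<close>, and
  \<open>X\<^sup>m = M\<^sup>m - (\<Sum>i<m. X\<^sup>i u e\<^sup>T M\<^bsup>m-1-i\<^esup>)\<close>, where \<open>X\<^sup>i u = (M + M\<^sup>2 + M\<^sup>3) e\<close> for all \<open>i \<ge> 2\<close>.
  The trace of this correction is therefore a sum of the numbers \<open>e\<^sup>T M\<^sup>j e\<close>, and everything is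
  multiplied by \<open>c\<close> when \<open>m\<close> grows by 3.
\<close>

section \<open>Matrix powers and weighted walks\<close>

primrec kernel_pow :: "'a set \<Rightarrow> ('a \<Rightarrow> 'a \<Rightarrow> 'b::comm_ring_1) \<Rightarrow> nat \<Rightarrow> 'a \<Rightarrow> 'a \<Rightarrow> 'b" where
  "kernel_pow S K 0 = (\<lambda>x y. of_bool (x = y))"
| "kernel_pow S K (Suc j) = (\<lambda>x y. \<Sum>w\<in>S. K x w * kernel_pow S K j w y)"

lemma kernel_pow_1:
  assumes "finite S" "y \<in> S"
  shows "kernel_pow S K (Suc 0) x y = K x y"
  using assms by (simp add: of_bool_def if_distrib[of "(*) _"] cong: if_cong)

lemma kernel_pow_add:
  assumes "finite S" "x \<in> S"
  shows "kernel_pow S K (i + j) x y = (\<Sum>w\<in>S. kernel_pow S K i x w * kernel_pow S K j w y)"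
  using assms(2)
proof (induction i arbitrary: x)
  case 0
  then show ?case
    using assms(1) by (simp add: of_bool_def if_distrib[of "\<lambda>t. t * _"] cong: if_cong)
next
  case (Suc i)
  have "kernel_pow S K (Suc i + j) x y
      = (\<Sum>v\<in>S. \<Sum>w\<in>S. K x v * (kernel_pow S K i v w * kernel_pow S K j w y))"
    using Suc by (simp add: sum_distrib_left)
  also have "\<dots> = (\<Sum>w\<in>S. \<Sum>v\<in>S. K x v * (kernel_pow S K i v w * kernel_pow S K j w y))"
    by (rule sum.swap)
  finally show ?case
    by (simp add: sum_distrib_right mult.assoc)
qed

lemma kernel_pow_Suc_right:
  assumes "finite S" "x \<in> S" "y \<in> S"
  shows "kernel_pow S K (Suc j) x y = (\<Sum>w\<in>S. kernel_pow S K j x w * K w y)"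
proof -
  have "kernel_pow S K (j + Suc 0) x y = (\<Sum>w\<in>S. kernel_pow S K j x w * K w y)"
    unfolding kernel_pow_add[OF assms(1,2)] kernel_pow_1[OF assms(1,3)] ..
  then show ?thesis by simp
qed

text \<open>The endpoint weight \<open>g\<close> is arbitrary so that the induction can remove the
  last vertex: its step and the old weight are summed into a new endpoint weight.\<close>

lemma sum_walks:
  fixes K g :: "'a \<Rightarrow> 'a \<Rightarrow> 'b::comm_ring_1"
  assumes "finite S"
  shows "(\<Sum>f\<in>{..<Suc m} \<rightarrow>\<^sub>E S. (\<Prod>i<m. K (f i) (f (Suc i))) * g (f 0) (f m))
    = (\<Sum>x\<in>S. \<Sum>y\<in>S. kernel_pow S K m x y * g x y)"
proof (induction m arbitrary: g)
  case 0
  have "(\<Sum>f\<in>{..<Suc 0} \<rightarrow>\<^sub>E S. g (f 0) (f 0)) = (\<Sum>x\<in>S. g x x)"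
    by (rule sum.reindex_bij_witness[of _ "\<lambda>x. (\<lambda>_. undefined)(0 := x)" "\<lambda>f. f 0"])
      (auto simp: PiE_iff extensional_def fun_eq_iff)
  also have "\<dots> = (\<Sum>x\<in>S. \<Sum>y\<in>S. kernel_pow S K 0 x y * g x y)"
    using assms
    by (simp add: of_bool_def if_distrib[of "\<lambda>t. t * _"] cong: if_cong)
  finally show ?case by simp
next
  case (Suc m)
  let ?W = "\<lambda>f. \<Prod>i<m. K (f i) (f (Suc i))"
  have "({..<Suc (Suc m)} \<rightarrow>\<^sub>E S)
      = (\<lambda>(y, f). f(Suc m := y)) ` (S \<times> ({..<Suc m} \<rightarrow>\<^sub>E S))"
    unfolding lessThan_Suc[of "Suc m"] by (rule PiE_insert_eq)
  moreover have "inj_on (\<lambda>(y, f). f(Suc m := y)) (S \<times> ({..<Suc m} \<rightarrow>\<^sub>E S))"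
    by (rule inj_combinator) auto
  ultimately have "(\<Sum>f\<in>{..<Suc (Suc m)} \<rightarrow>\<^sub>E S.
        (\<Prod>i<Suc m. K (f i) (f (Suc i))) * g (f 0) (f (Suc m)))
      = (\<Sum>y\<in>S. \<Sum>f\<in>{..<Suc m} \<rightarrow>\<^sub>E S. ?W f * K (f m) y * g (f 0) y)"
    by (simp add: sum.reindex sum.cartesian_product case_prod_unfold)
  also have "\<dots> = (\<Sum>f\<in>{..<Suc m} \<rightarrow>\<^sub>E S. ?W f * (\<Sum>y\<in>S. K (f m) y * g (f 0) y))"
    by (subst sum.swap) (simp add: sum_distrib_left mult.assoc)
  also have "\<dots> = (\<Sum>x\<in>S. \<Sum>w\<in>S. kernel_pow S K m x w * (\<Sum>y\<in>S. K w y * g x y))"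
    by (rule Suc.IH)
  also have "\<dots> = (\<Sum>x\<in>S. \<Sum>y\<in>S. (\<Sum>w\<in>S. kernel_pow S K m x w * K w y) * g x y)"
    unfolding sum_distrib_left sum_distrib_right
    by (simp only: mult.assoc, rule sum.cong[OF refl], rule sum.swap)
  also have "\<dots> = (\<Sum>x\<in>S. \<Sum>y\<in>S. kernel_pow S K (Suc m) x y * g x y)"
    using assms by (intro sum.cong refl) (simp only: kernel_pow_Suc_right)
  finally show ?case .
qed

text \<open>The closing step back to \<open>f 0\<close> serves as the endpoint weight of an open
  walk with one step fewer.\<close>

lemma sum_closed_walks:
  fixes K :: "'a \<Rightarrow> 'a \<Rightarrow> 'b::comm_ring_1"
  assumes "finite S" "m > 0"
  shows "(\<Sum>f\<in>{..<m} \<rightarrow>\<^sub>E S. \<Prod>i<m. K (f i) (f (Suc i mod m)))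
    = (\<Sum>x\<in>S. kernel_pow S K m x x)"
proof -
  obtain p where m: "m = Suc p" using assms(2) gr0_implies_Suc by blast
  have "(\<Sum>f\<in>{..<m} \<rightarrow>\<^sub>E S. \<Prod>i<m. K (f i) (f (Suc i mod m)))
      = (\<Sum>f\<in>{..<Suc p} \<rightarrow>\<^sub>E S. (\<Prod>i<p. K (f i) (f (Suc i))) * K (f p) (f 0))"
    unfolding m by simp
  also have "\<dots> = (\<Sum>x\<in>S. \<Sum>y\<in>S. kernel_pow S K p x y * K y x)"
    using sum_walks[OF assms(1), where g = "\<lambda>x y. K y x"] .
  also have "\<dots> = (\<Sum>x\<in>S. kernel_pow S K (Suc p) x x)"
    using assms(1) by (intro sum.cong refl) (simp only: kernel_pow_Suc_right)
  finally show ?thesis by (simp only: m)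
qed

section \<open>Forbidding one vertex\<close>

text \<open>Subtracting u e^T deletes the column of \<open>z\<close> and nothing else: steps into
  \<open>z\<close> are barred, steps out of it are not. A closed walk that never enters
  \<open>z\<close> avoids it altogether.\<close>

definition taboo :: "'a \<Rightarrow> ('a \<Rightarrow> 'a \<Rightarrow> 'b) \<Rightarrow> 'a \<Rightarrow> 'a \<Rightarrow> 'b::comm_ring_1" where
  "taboo z K x y = (if y = z then 0 else K x y)"

lemma sum_taboo:
  assumes "finite S" "z \<in> S"
  shows "(\<Sum>w\<in>S. taboo z K x w * h w) = (\<Sum>w\<in>S. K x w * h w) - K x z * h z"
  using assms by (simp add: taboo_def sum.remove[of S z] if_distrib[of "\<lambda>t. t * _"])

text \<open>The column \<open>X\<^sup>i u\<close> for \<open>X = taboo z K\<close> and \<open>u = K(-, z)\<close>.\<close>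

primrec taboo_column :: "'a set \<Rightarrow> 'a \<Rightarrow> ('a \<Rightarrow> 'a \<Rightarrow> 'b::comm_ring_1) \<Rightarrow> nat \<Rightarrow> 'a \<Rightarrow> 'b" where
  "taboo_column S z K 0 x = K x z"
| "taboo_column S z K (Suc i) x = (\<Sum>w\<in>S. taboo z K x w * taboo_column S z K i w)"

text \<open>First-entrance decomposition: a walk that enters \<open>z\<close> does so first after
  some \<open>i\<close> steps of the taboo matrix, and it continues freely from there.\<close>

lemma kernel_pow_taboo:
  assumes "finite S" "z \<in> S"
  shows "kernel_pow S (taboo z K) m x y = kernel_pow S K m x y
    - (\<Sum>i<m. taboo_column S z K i x * kernel_pow S K (m - Suc i) z y)"
proof (induction m arbitrary: x)
  case (Suc m)
  have "kernel_pow S (taboo z K) (Suc m) x y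
      = (\<Sum>w\<in>S. taboo z K x w * kernel_pow S K m w y)
        - (\<Sum>w\<in>S. \<Sum>i<m. taboo z K x w * (taboo_column S z K i w * kernel_pow S K (m - Suc i) z y))"
    by (simp add: Suc right_diff_distrib sum_subtractf sum_distrib_left)
  also have "(\<Sum>w\<in>S. taboo z K x w * kernel_pow S K m w y)
      = kernel_pow S K (Suc m) x y - K x z * kernel_pow S K m z y"
    by (simp add: sum_taboo[OF assms])
  also have "(\<Sum>w\<in>S. \<Sum>i<m. taboo z K x w * (taboo_column S z K i w * kernel_pow S K (m - Suc i) z y))
      = (\<Sum>i<m. taboo_column S z K (Suc i) x * kernel_pow S K (m - Suc i) z y)"
    by (subst sum.swap) (simp add: sum_distrib_right mult.assoc)
  finally show ?case
    by (simp add: sum.lessThan_Suc_shift del: sum.lessThan_Suc kernel_pow.simps)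
qed simp

section \<open>The signed disjointness matrix as a Kronecker power\<close>

text \<open>The matrix \<open>P\<close>; \<^const>\<open>False\<close> is its first index.\<close>

definition point_kernel :: "bool \<Rightarrow> bool \<Rightarrow> int" where
  "point_kernel p q = (if p then (if q then 0 else -1) else 1)"

text \<open>P has trace 1 and determinant 1, so P^2 - P + 1 = 0, and x^2 - x + 1 divides x^3 +
  1.\<close>

lemma kernel_pow_point_add3:
  "kernel_pow UNIV point_kernel (j + 3) p q = - kernel_pow UNIV point_kernel j p q"
  by (cases p; cases q) (simp_all add: numeral_3_eq_3 UNIV_bool point_kernel_def)

text \<open>The outer minus sign turns the sign of \<open>card A\<close> into that of
  \<open>card A - 1\<close>, so each step of a walk carries the dimension of the simplex it starts
  from.\<close>

definition disjoint_kernel :: "nat \<Rightarrow> nat set \<Rightarrow> nat set \<Rightarrow> int" where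
  "disjoint_kernel n A B = - (\<Prod>v<n. point_kernel (v \<in> A) (v \<in> B))"

lemma disjoint_kernel_eq:
  assumes "A \<subseteq> {..<n}"
  shows "disjoint_kernel n A B = (if A \<inter> B = {} then - ((-1) ^ card A) else 0)"
proof (cases "A \<inter> B = {}")
  case True
  have "(\<Prod>v<n. point_kernel (v \<in> A) (v \<in> B)) = (\<Prod>v<n. if v \<in> A then -1 else 1)"
    using True by (intro prod.cong refl) (auto simp: point_kernel_def)
  also have "\<dots> = (-1) ^ card A"
    using assms by (simp add: prod.If_cases Int_absorb1)
  finally show ?thesis using True by (simp add: disjoint_kernel_def)
next
  case False
  then obtain v where "v \<in> A" "v \<in> B" by blast
  then have "\<exists>v\<in>{..<n}. point_kernel (v \<in> A) (v \<in> B) = 0"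
    using assms by (intro bexI[of _ v]) (auto simp: point_kernel_def)
  then show ?thesis using False by (simp add: disjoint_kernel_def)
qed

lemma sum_Pow_prod:
  fixes h :: "'a \<Rightarrow> bool \<Rightarrow> 'b::comm_ring_1"
  assumes "finite V"
  shows "(\<Sum>C\<in>Pow V. \<Prod>v\<in>V. h v (v \<in> C)) = (\<Prod>v\<in>V. h v True + h v False)"
proof -
  have "(\<Prod>v\<in>V. h v (v \<in> C)) = (\<Prod>v\<in>C. h v True) * (\<Prod>v\<in>V - C. h v False)"
    if "C \<in> Pow V" for C
    using that assms by (subst prod.subset_diff[of C]) (auto simp: mult.commute)
  then show ?thesis
    using assms by (simp add: prod_add)
qed

text \<open>Powers of a Kronecker product are Kronecker products of powers: summing over the
  intermediate set \<open>C\<close> amounts to an independent choice of membership for each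
  point.\<close>

lemma kernel_pow_disjoint:
  assumes "A \<subseteq> {..<n}" "B \<subseteq> {..<n}"
  shows "kernel_pow (Pow {..<n}) (disjoint_kernel n) j A B
    = (-1) ^ j * (\<Prod>v<n. kernel_pow UNIV point_kernel j (v \<in> A) (v \<in> B))"
  using assms(1)
proof (induction j arbitrary: A)
  case 0
  show ?case
  proof (cases "A = B")
    case False
    then obtain v where "v < n" "(v \<in> A) \<noteq> (v \<in> B)"
      using 0 assms(2) by blast
    then have "(\<Prod>v<n. of_bool ((v \<in> A) = (v \<in> B))) = (0::int)"
      by (intro prod_zero) auto
    then show ?thesis using False by simp
  qed simp
next
  case (Suc j)
  have "kernel_pow (Pow {..<n}) (disjoint_kernel n) (Suc j) A B
      = (\<Sum>C\<in>Pow {..<n}. (-1) ^ Suc j * (\<Prod>v<n. point_kernel (v \<in> A) (v \<in> C)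
          * kernel_pow UNIV point_kernel j (v \<in> C) (v \<in> B)))"
    by (simp add: Suc disjoint_kernel_def prod.distrib mult_ac)
  also have "\<dots> = (-1) ^ Suc j * (\<Prod>v<n. kernel_pow UNIV point_kernel (Suc j) (v \<in> A) (v \<in> B))"
    unfolding sum_distrib_left[symmetric]
    by (subst sum_Pow_prod[of _ "\<lambda>v q. point_kernel (v \<in> A) q
          * kernel_pow UNIV point_kernel j q (v \<in> B)"]) (simp_all add: UNIV_bool add.commute)
  finally show ?case .
qed

text \<open>Three outer minus signs give -1 and the \<open>n\<close> factors P^3 = -1 give (-1)^n;
  the product is c.\<close>

lemma kernel_pow_disjoint_add3:
  assumes "A \<subseteq> {..<n}" "B \<subseteq> {..<n}"
  shows "kernel_pow (Pow {..<n}) (disjoint_kernel n) (j + 3) A B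
    = (-1) ^ Suc n * kernel_pow (Pow {..<n}) (disjoint_kernel n) j A B"
  using assms by (simp add: kernel_pow_disjoint kernel_pow_point_add3 prod_uminus power_add
      del: kernel_pow.simps)

section \<open>Returns to the empty set, and traces\<close>

text \<open>The number e^T M^j e, written a_j in the comments below.\<close>

definition empty_return :: "nat \<Rightarrow> nat \<Rightarrow> int" where
  "empty_return n j = kernel_pow (Pow {..<n}) (disjoint_kernel n) j {} {}"

lemma empty_return_add3: "empty_return n (j + 3) = (-1) ^ Suc n * empty_return n j"
  unfolding empty_return_def by (rule kernel_pow_disjoint_add3) auto

lemma empty_return_eq:
  "empty_return n j = (-1) ^ j * kernel_pow UNIV point_kernel j False False ^ n"
  unfolding empty_return_def by (subst kernel_pow_disjoint) auto

text \<open>P^2 = P - 1 vanishes at (\<open>False\<close>, \<open>False\<close>), so a_2 is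
  \<open>0 ^ n\<close>, which is 0 because \<open>n > 0\<close>.\<close>

lemma empty_return_small:
  assumes "n > 0"
  shows "empty_return n 0 = 1" "empty_return n (Suc 0) = -1" "empty_return n 2 = 0"
  using assms by (simp_all add: empty_return_eq numeral_2_eq_2 UNIV_bool point_kernel_def)

definition disjoint_trace :: "nat \<Rightarrow> nat \<Rightarrow> int" where
  "disjoint_trace n m = (\<Sum>A\<in>Pow {..<n}. kernel_pow (Pow {..<n}) (disjoint_kernel n) m A A)"

lemma disjoint_trace_add3: "disjoint_trace n (m + 3) = (-1) ^ Suc n * disjoint_trace n m"
  unfolding disjoint_trace_def sum_distrib_left
  by (intro sum.cong refl kernel_pow_disjoint_add3) auto

text \<open>The trace of a Kronecker power is the power of the trace.\<close>

lemma disjoint_trace_eq: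
  "disjoint_trace n m
    = (-1) ^ m * (kernel_pow UNIV point_kernel m True True + kernel_pow UNIV point_kernel m False False) ^ n"
proof -
  have "disjoint_trace n m
      = (\<Sum>A\<in>Pow {..<n}. (-1) ^ m * (\<Prod>v<n. kernel_pow UNIV point_kernel m (v \<in> A) (v \<in> A)))"
    unfolding disjoint_trace_def by (intro sum.cong refl kernel_pow_disjoint) auto
  then show ?thesis
    using sum_Pow_prod[of "{..<n}" "\<lambda>_ q. kernel_pow UNIV point_kernel m q q"]
    by (simp add: sum_distrib_left[symmetric])
qed

text \<open>The matrices 1, P and P^2 = P - 1 have traces 2, 1 and -1.\<close>

lemma disjoint_trace_small:
  "disjoint_trace n 0 = 2 ^ n" "disjoint_trace n (Suc 0) = -1" "disjoint_trace n 2 = (-1) ^ n"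
  by (simp_all add: disjoint_trace_eq numeral_2_eq_2 UNIV_bool point_kernel_def)

section \<open>The trace once the empty set is forbidden\<close>

text \<open>Since X h = M h - (e^T h) M e, one has X M^j e = M^(j+1) e - a_j M e. With a_1 = -1 and
  a_2 = 0 the columns grow to (M + M^2 + M^3) e, which X fixes.\<close>

lemma taboo_column_disjoint:
  fixes n :: nat
  defines "M \<equiv> kernel_pow (Pow {..<n}) (disjoint_kernel n)"
    and "L \<equiv> taboo_column (Pow {..<n}) {} (disjoint_kernel n)"
  assumes "n > 0" "A \<subseteq> {..<n}"
  shows "L 0 A = M 1 A {}"
    and "L (Suc 0) A = M 1 A {} + M 2 A {}"
    and "L (Suc (Suc i)) A = M 1 A {} + M 2 A {} + M 3 A {}"
proof -
  have K: "disjoint_kernel n B {} = M 1 B {}" for B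
    unfolding M_def One_nat_def by (subst kernel_pow_1) auto
  have step: "(\<Sum>C\<in>Pow {..<n}. taboo {} (disjoint_kernel n) B C * M j C {})
      = M (Suc j) B {} - M 1 B {} * empty_return n j" for B j
    by (subst sum_taboo) (simp_all add: K, simp add: M_def empty_return_def)
  note a = empty_return_small[OF assms(3)]
  have a1: "empty_return n 1 = -1" using a by simp
  have a3: "empty_return n 3 = (-1) ^ Suc n"
    using empty_return_add3[of n 0] a by simp
  have L0: "L 0 B = M 1 B {}" for B
    by (simp only: L_def taboo_column.simps K)
  have LS: "L (Suc i) B = (\<Sum>C\<in>Pow {..<n}. taboo {} (disjoint_kernel n) B C * L i C)" for i B
    by (simp add: L_def)
  have L1: "L (Suc 0) B = M 1 B {} + M 2 B {}" for B
    unfolding LS L0 step a1 by (simp add: numeral_2_eq_2)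
  have M4: "M (Suc 3) B {} = (-1) ^ Suc n * M 1 B {}" if "B \<subseteq> {..<n}" for B
    using kernel_pow_disjoint_add3[of B n "{}" 1] that by (simp add: M_def del: kernel_pow.simps)
  have L2: "L (Suc (Suc i)) B = M 1 B {} + M 2 B {} + M 3 B {}" if "B \<subseteq> {..<n}" for i B
    using that
  proof (induction i arbitrary: B)
    case 0
    show ?case
      unfolding LS[of "Suc 0"] L1 distrib_left sum.distrib step a1 a
      by (simp add: numeral_2_eq_2 numeral_3_eq_3)
  next
    case (Suc i)
    have "L (Suc (Suc (Suc i))) B = (\<Sum>C\<in>Pow {..<n}. taboo {} (disjoint_kernel n) B C
        * (M 1 C {} + M 2 C {} + M 3 C {}))"
      unfolding LS[of "Suc (Suc i)"] using Suc.IH by (intro sum.cong refl) simp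
    \<comment> \<open>M^4 e = c M e cancels against a_3 M e with a_3 = c, while - a_1 M e restores
      the missing M e.\<close>
    also have "\<dots> = M 1 B {} + M 2 B {} + M 3 B {}"
      unfolding distrib_left sum.distrib step a1 a a3 M4[OF Suc.prems]
      by (simp add: numeral_2_eq_2 numeral_3_eq_3)
    finally show ?case .
  qed
  show "L 0 A = M 1 A {}" "L (Suc 0) A = M 1 A {} + M 2 A {}"
    "L (Suc (Suc i)) A = M 1 A {} + M 2 A {} + M 3 A {}"
    using L0 L1 L2 assms(4) by auto
qed

lemma trace_taboo_disjoint:
  assumes "n > 0" "m \<ge> 2"
  shows "(\<Sum>A\<in>Pow {..<n}. kernel_pow (Pow {..<n}) (taboo {} (disjoint_kernel n)) m A A)
    = disjoint_trace n m - 3 * (\<Sum>j<m. empty_return n (Suc j)) - 2"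
proof -
  define M where "M = kernel_pow (Pow {..<n}) (disjoint_kernel n)"
  define L where "L = taboo_column (Pow {..<n}) {} (disjoint_kernel n)"
  obtain p where m: "m = Suc (Suc p)"
    using assms(2) by (metis add_2_eq_Suc le_Suc_ex)
  \<comment> \<open>The trace of M^i e e^T M^j is a_(i+j).\<close>
  have conv: "(\<Sum>A\<in>Pow {..<n}. M i A {} * M j {} A) = empty_return n (i + j)" for i j
    unfolding M_def empty_return_def by (subst add.commute, subst kernel_pow_add) (auto simp: mult.commute)
  \<comment> \<open>This \<open>c i j\<close> is the trace of X^i u e^T M^j, not the sign c.\<close>
  define c where "c = (\<lambda>i j. \<Sum>A\<in>Pow {..<n}. L i A * M j {} A)"
  note L = taboo_column_disjoint[OF assms(1), folded M_def L_def]
  have c0: "c 0 j = empty_return n (1 + j)" for j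
    unfolding c_def by (subst conv[symmetric], intro sum.cong refl) (simp add: L)
  have c1: "c (Suc 0) j = empty_return n (1 + j) + empty_return n (2 + j)" for j
    unfolding c_def conv[symmetric] sum.distrib[symmetric]
    by (intro sum.cong refl) (simp add: L distrib_right)
  have c2: "c (Suc (Suc i)) j
      = empty_return n (1 + j) + empty_return n (2 + j) + empty_return n (3 + j)" for i j
    unfolding c_def conv[symmetric] sum.distrib[symmetric]
    by (intro sum.cong refl) (simp add: L distrib_right)
  have "(\<Sum>A\<in>Pow {..<n}. kernel_pow (Pow {..<n}) (taboo {} (disjoint_kernel n)) m A A)
      = disjoint_trace n m - (\<Sum>A\<in>Pow {..<n}. \<Sum>i<m. L i A * M (m - Suc i) {} A)"
    unfolding L_def M_def disjoint_trace_def
    by (subst kernel_pow_taboo) (auto simp: sum_subtractf)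
  also have "(\<Sum>A\<in>Pow {..<n}. \<Sum>i<m. L i A * M (m - Suc i) {} A) = (\<Sum>i<m. c i (m - Suc i))"
    unfolding c_def by (rule sum.swap)
  \<comment> \<open>The columns are stable only from index 2 on, so the first two terms are split
    off.\<close>
  also have "\<dots> = c 0 (Suc p) + c (Suc 0) p + (\<Sum>i<p. c (Suc (Suc i)) (p - Suc i))"
    unfolding m by (simp add: sum.lessThan_Suc_shift del: sum.lessThan_Suc)
  also have "(\<Sum>i<p. c (Suc (Suc i)) (p - Suc i))
      = (\<Sum>j<p. empty_return n (1 + j) + empty_return n (2 + j) + empty_return n (3 + j))"
    unfolding c2
    by (rule sum.nat_diff_reindex[of "\<lambda>j. empty_return n (1 + j) + empty_return n (2 + j) + empty_return n (3 + j)"])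
  \<comment> \<open>Completed by the terms split off, the three shifted sums end at a_m and start at
    a_1, a_2 and a_3. They fall short of three full sums by 2 a_1 + a_2 = -2.\<close>
  also have "c 0 (Suc p) + c (Suc 0) p + \<dots> = 3 * (\<Sum>j<m. empty_return n (Suc j)) + 2"
    unfolding c0 c1 m
    using empty_return_small[OF assms(1)]
    by (induction p) (simp_all add: numeral_2_eq_2 numeral_3_eq_3)
  finally show ?thesis by simp
qed

section \<open>Cells as closed walks\<close>

lemma euler_char_Hom_cycle_complete:
  assumes "m \<ge> 2"
  shows "euler_char (pverts (cycle_graph m)) (Hom_complex (cycle_graph m) (complete_graph n))
    = (\<Sum>A\<in>Pow {..<n}. kernel_pow (Pow {..<n}) (taboo {} (disjoint_kernel n)) m A A)"
proof -
  let ?H = "Hom_complex (cycle_graph m) (complete_graph n)"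
  let ?w = "\<lambda>\<sigma>. \<Prod>i<m. taboo {} (disjoint_kernel n) (\<sigma> i) (\<sigma> (Suc i mod m))"
  \<comment> \<open>Nonemptiness is stated at the head of each step, where \<open>taboo\<close>
    tests it; every index is such a head. Disjointness is symmetric, so one orientation of each edge
    suffices.\<close>
  have H: "\<sigma> \<in> ?H \<longleftrightarrow> \<sigma> \<in> {..<m} \<rightarrow>\<^sub>E Pow {..<n} \<and>
      (\<forall>i<m. \<sigma> (Suc i mod m) \<noteq> {} \<and> \<sigma> i \<inter> \<sigma> (Suc i mod m) = {})" for \<sigma>
  proof
    assume "\<sigma> \<in> ?H"
    then have s: "\<sigma> \<in> {..<m} \<rightarrow>\<^sub>E {S. S \<subseteq> {..<n} \<and> finite S \<and> S \<noteq> {}}"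
      and d: "\<And>i j. i < m \<Longrightarrow> j < m \<Longrightarrow> j = Suc i mod m \<Longrightarrow> \<sigma> i \<times> \<sigma> j \<subseteq> {(i, j). i < n \<and> j < n \<and> i \<noteq> j}"
      by (auto simp: Hom_complex_def simplex_product_def cycle_graph_def complete_graph_def)
    have "\<sigma> (Suc i mod m) \<noteq> {}" "\<sigma> i \<inter> \<sigma> (Suc i mod m) = {}" if "i < m" for i
    proof -
      have "Suc i mod m < m" using that by simp
      then show "\<sigma> (Suc i mod m) \<noteq> {}" "\<sigma> i \<inter> \<sigma> (Suc i mod m) = {}"
        using s d[OF that, of "Suc i mod m"] by (auto dest: PiE_mem)
    qed
    then show "\<sigma> \<in> {..<m} \<rightarrow>\<^sub>E Pow {..<n} \<and>
      (\<forall>i<m. \<sigma> (Suc i mod m) \<noteq> {} \<and> \<sigma> i \<inter> \<sigma> (Suc i mod m) = {})"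
      using s by (auto simp: PiE_iff)
  next
    assume r: "\<sigma> \<in> {..<m} \<rightarrow>\<^sub>E Pow {..<n} \<and>
      (\<forall>i<m. \<sigma> (Suc i mod m) \<noteq> {} \<and> \<sigma> i \<inter> \<sigma> (Suc i mod m) = {})"
    have ne: "\<sigma> i \<noteq> {}" if "i < m" for i
    proof -
      obtain j where "j < m" "Suc j mod m = i"
      proof (cases i)
        case 0
        then show thesis using that[of "m - 1"] \<open>i < m\<close> by simp
      next
        case (Suc j)
        then show thesis using that[of j] \<open>i < m\<close> by simp
      qed
      then show ?thesis using r by blast
    qed
    have sub: "\<sigma> i \<subseteq> {..<n}" if "i < m" for i
      using r that by (auto dest: PiE_mem)
    have "\<sigma> \<in> {..<m} \<rightarrow>\<^sub>E {S. S \<subseteq> {..<n} \<and> finite S \<and> S \<noteq> {}}"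
      using r ne sub finite_subset[OF _ finite_lessThan[of n]] by (auto simp: PiE_iff)
    moreover have "\<sigma> i \<times> \<sigma> j \<subseteq> {(i, j). i < n \<and> j < n \<and> i \<noteq> j}"
      if "i < m" "j < m" "j = Suc i mod m \<or> i = Suc j mod m" for i j
      using sub[OF that(1)] sub[OF that(2)] r that by blast
    ultimately show "\<sigma> \<in> ?H"
      by (auto simp: Hom_complex_def simplex_product_def cycle_graph_def complete_graph_def)
  qed
  have w: "(-1) ^ cell_dim {..<m} \<sigma> = ?w \<sigma>" if "\<sigma> \<in> ?H" for \<sigma>
  proof -
    have "(-1) ^ (card (\<sigma> i) - 1) = taboo {} (disjoint_kernel n) (\<sigma> i) (\<sigma> (Suc i mod m))"
      if "i < m" for i
    proof -
      have "\<sigma> i \<subseteq> {..<n}" "\<sigma> i \<noteq> {}"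
        using \<open>\<sigma> \<in> ?H\<close> that
        by (auto simp: Hom_complex_def simplex_product_def cycle_graph_def complete_graph_def PiE_iff)
      moreover from this have "card (\<sigma> i) > 0"
        by (simp add: card_gt_0_iff finite_subset[OF _ finite_lessThan[of n]])
      then obtain d where "card (\<sigma> i) = Suc d" using gr0_implies_Suc by blast
      ultimately show ?thesis
        using \<open>\<sigma> \<in> ?H\<close> that by (simp add: H taboo_def disjoint_kernel_eq)
    qed
    then show ?thesis
      unfolding cell_dim_def power_sum by (intro prod.cong refl) simp
  qed
  have "euler_char (pverts (cycle_graph m)) ?H = (\<Sum>\<sigma>\<in>?H. ?w \<sigma>)"
    unfolding euler_char_def by (intro sum.cong refl) (simp add: cycle_graph_def w)
  \<comment> \<open>Any other family has a step into the empty set or between intersecting sets, and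
    the factor of that step is 0.\<close>
  also have "\<dots> = (\<Sum>\<sigma>\<in>{..<m} \<rightarrow>\<^sub>E Pow {..<n}. ?w \<sigma>)"
  proof (rule sum.mono_neutral_left)
    show "finite ({..<m} \<rightarrow>\<^sub>E Pow {..<n})" by (intro finite_PiE) auto
    show "?H \<subseteq> {..<m} \<rightarrow>\<^sub>E Pow {..<n}" by (rule subsetI) (simp only: H)
    show "\<forall>\<sigma>\<in>({..<m} \<rightarrow>\<^sub>E Pow {..<n}) - ?H. ?w \<sigma> = 0"
    proof
      fix \<sigma> assume "\<sigma> \<in> ({..<m} \<rightarrow>\<^sub>E Pow {..<n}) - ?H"
      then have "\<sigma> \<in> {..<m} \<rightarrow>\<^sub>E Pow {..<n}" and "\<sigma> \<notin> ?H" by simp_all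
      then obtain i where "i < m" "\<sigma> (Suc i mod m) = {} \<or> \<sigma> i \<inter> \<sigma> (Suc i mod m) \<noteq> {}"
        unfolding H by blast
      moreover from this have "\<sigma> i \<subseteq> {..<n}"
        using \<open>\<sigma> \<in> {..<m} \<rightarrow>\<^sub>E Pow {..<n}\<close> by (auto dest: PiE_mem)
      ultimately have "taboo {} (disjoint_kernel n) (\<sigma> i) (\<sigma> (Suc i mod m)) = 0"
        by (auto simp: taboo_def disjoint_kernel_eq)
      then show "?w \<sigma> = 0"
        using \<open>i < m\<close> by (intro prod_zero) auto
    qed
  qed
  also have "\<dots> = (\<Sum>A\<in>Pow {..<n}. kernel_pow (Pow {..<n}) (taboo {} (disjoint_kernel n)) m A A)"
    using assms by (intro sum_closed_walks) auto
  finally show ?thesis .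
qed

section \<open>Period three in the length of the cycle\<close>

text \<open>For \<open>n > 0\<close> and \<open>m \<ge> 2\<close> this is the reduced Euler
  characteristic. As a formula it makes sense for every \<open>m\<close>, so the recursion can
  descend to 0, 1 and 2.\<close>

definition cycle_char :: "nat \<Rightarrow> nat \<Rightarrow> int" where
  "cycle_char n m = disjoint_trace n m - 3 * (\<Sum>j<m. empty_return n (Suc j)) - 3"

text \<open>The first period contributes a_1 + a_2 + a_3 = c - 1, so the constant becomes -3 (c - 1)
  - 3 = -3 c and scales by c like the other terms.\<close>

lemma cycle_char_add3:
  assumes "n > 0"
  shows "cycle_char n (m + 3) = (-1) ^ Suc n * cycle_char n m"
proof -
  have "(\<Sum>j<m + 3. empty_return n (Suc j))
      = (\<Sum>j<3. empty_return n (Suc j)) + (\<Sum>j<m. empty_return n (Suc j + 3))"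
  proof (induction m)
    case (Suc m)
    have "Suc m + 3 = Suc (m + 3)" by simp
    then show ?case using Suc by (simp only: sum.lessThan_Suc add.assoc add_Suc)
  qed simp
  also have "(\<Sum>j<3. empty_return n (Suc j)) = (-1) ^ Suc n - 1"
    using empty_return_small[OF assms] empty_return_add3[of n 0]
    by (simp add: numeral_2_eq_2 numeral_3_eq_3)
  also have "(\<Sum>j<m. empty_return n (Suc j + 3)) = (-1) ^ Suc n * (\<Sum>j<m. empty_return n (Suc j))"
    by (simp only: empty_return_add3 sum_distrib_left)
  finally show ?thesis
    unfolding cycle_char_def disjoint_trace_add3 by (simp add: algebra_simps)
qed

lemma cycle_char_add_mult3:
  assumes "n > 0"
  shows "cycle_char n (3 * q + r) = (-1) ^ (Suc n * q) * cycle_char n r"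
proof (induction q)
  case (Suc q)
  have "cycle_char n (3 * Suc q + r) = cycle_char n ((3 * q + r) + 3)"
    by (simp add: algebra_simps)
  then show ?case
    unfolding cycle_char_add3[OF assms] Suc by (simp add: power_add)
qed simp

lemma cycle_char_small:
  assumes "n > 0"
  shows "cycle_char n 0 = 2 ^ n - 3" "cycle_char n (Suc 0) = -1" "cycle_char n 2 = (-1) ^ n"
  using empty_return_small[OF assms] disjoint_trace_small
  by (simp_all add: cycle_char_def numeral_2_eq_2)

lemma reduced_euler_char_eq_cycle_char:
  assumes "n > 0" "m \<ge> 2"
  shows "reduced_euler_char (pverts (cycle_graph m)) (Hom_complex (cycle_graph m) (complete_graph n))
    = cycle_char n m"
  unfolding reduced_euler_char_def euler_char_Hom_cycle_complete[OF assms(2)]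
    trace_taboo_disjoint[OF assms] cycle_char_def by simp

lemma minus_one_powi_eq_power:
  "even (i - int j) \<Longrightarrow> (- 1 :: 'a::field) powi i = (- 1) ^ j"
  by (cases "even i") (auto simp: minus_one_power_iff)

theorem corollary6p4:
  fixes m n :: nat and k :: int
  assumes "m \<ge> 5" and "n \<ge> 4"
  shows "(int m = 3 * k + 1 \<or> int m = 3 * k - 1 \<longrightarrow>
      real_of_int (reduced_euler_char (pverts (cycle_graph m))
          (Hom_complex (cycle_graph m) (complete_graph n)))
        = (- 1) powi (int n * k - int m)) \<and>
    (int m = 3 * k \<longrightarrow>
      real_of_int (reduced_euler_char (pverts (cycle_graph m))
          (Hom_complex (cycle_graph m) (complete_graph n)))
        = (- 1) powi (int n * k - int m) * (2 ^ n - 3))"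
proof -
  have n: "n > 0" and m: "m \<ge> 2" using assms by auto
  note char = reduced_euler_char_eq_cycle_char[OF n m]
  \<comment> \<open>For m = 3 k - 1 the remainder is 2 and the quotient is k - 1. In case
    \<open>none\<close> both implications are vacuous.\<close>
  consider (zero) q where "k = int q" "m = 3 * q + 0" | (one) q where "k = int q" "m = 3 * q + Suc 0"
    | (two) q where "k = int q + 1" "m = 3 * q + 2"
    | (none) "int m \<noteq> 3 * k" "int m \<noteq> 3 * k + 1" "int m \<noteq> 3 * k - 1"
  proof -
    consider "int m = 3 * k" | "int m = 3 * k + 1" | "int m = 3 * k - 1"
      | "int m \<noteq> 3 * k" "int m \<noteq> 3 * k + 1" "int m \<noteq> 3 * k - 1" by blast
    then show thesis
    proof cases
      case 1
      then show thesis using that(1)[of "nat k"] by auto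
    next
      case 2
      then show thesis using that(2)[of "nat k"] m by auto
    next
      case 3
      then show thesis using that(3)[of "nat (k - 1)"] m by auto
    qed (use that in blast)
  qed
  then show ?thesis
  proof cases
    case zero
    have "cycle_char n m = (- 1) ^ (Suc n * q) * (2 ^ n - 3)"
      unfolding zero(2) cycle_char_add_mult3[OF n] cycle_char_small[OF n] by (simp add: power_add)
    \<comment> \<open>The exponents differ by -4 q here and by -4 q - 2 in the next two cases,
      always an even number.\<close>
    moreover have "(- 1 :: real) powi (int n * k - int m) = (- 1) ^ (Suc n * q)"
      unfolding zero by (rule minus_one_powi_eq_power) (simp add: algebra_simps)
    ultimately have "real_of_int (cycle_char n m) = (- 1) powi (int n * k - int m) * (2 ^ n - 3)"
      by simp
    moreover have "int m \<noteq> 3 * k + 1 \<and> int m \<noteq> 3 * k - 1"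
      using zero by presburger
    ultimately show ?thesis
      unfolding char by blast
  next
    case one
    have "cycle_char n m = (- 1) ^ Suc (Suc n * q)"
      unfolding one(2) cycle_char_add_mult3[OF n] cycle_char_small[OF n] by (simp add: power_add)
    moreover have "(- 1 :: real) powi (int n * k - int m) = (- 1) ^ Suc (Suc n * q)"
      unfolding one by (rule minus_one_powi_eq_power) (simp add: algebra_simps)
    ultimately have "real_of_int (cycle_char n m) = (- 1) powi (int n * k - int m)"
      by simp
    moreover have "int m \<noteq> 3 * k"
      using one by presburger
    ultimately show ?thesis
      unfolding char by blast
  next
    case two
    have "cycle_char n m = (- 1) ^ (Suc n * q + n)"
      unfolding two(2) cycle_char_add_mult3[OF n] cycle_char_small[OF n] by (simp add: power_add)
    moreover have "(- 1 :: real) powi (int n * k - int m) = (- 1) ^ (Suc n * q + n)"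
      unfolding two by (rule minus_one_powi_eq_power) (simp add: algebra_simps)
    ultimately have "real_of_int (cycle_char n m) = (- 1) powi (int n * k - int m)"
      by simp
    moreover have "int m \<noteq> 3 * k"
      using two by presburger
    ultimately show ?thesis
      unfolding char by blast
  next
    case none
    then show ?thesis by blast
  qed
qed

end
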